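(* Let $\hat X\in\mathbb{R}^{d\times d}$ be factorized as $\hat X=\hat U\hat V^T$ with $\hat U\in\mathcal{U}^{d\times s}$ and $\hat V\in\mathcal{V}^{d\times s}$ for some integer $s\ge 1$, and suppose that $\hat U$ has no zero column. Then $\hat X$ is a global minimizer of $f_\lambda$ over $\mathbb{R}^{d\times d}$ and $\hat X=\hat U\hat V^T$ is an optimal factorization (with respect to $\Omega$) if and only if there exists $\mu\in\mathbb{R}^d$ such that the following three conditions hold: (a) $\mathbf{u}^T\left(\mu\mathbf{1}_d^T-\nabla g(\hat X)\right)\mathbf{v}\le\lambda$ for all $\mathbf{u},\mathbf{v}\in\mathbb{R}^d_+$ with $\|\mathbf{u}\|_2=\|\mathbf{v}\|_2=1$; (b) $\left[\mu\mathbf{1}_s^T-\nabla g(\hat X)\hat V\right]_+=\lambda\,\hat U\,\mathrm{diag}\left\{\|\hat V_j\|_2/\|\hat U_j\|_2\right\}_{j=1}^s$; (c) $\left[\mathbf{1}_d\mu^T\hat U-(\nabla g(\hat X))^T\hat U\right]_+=\lambda\,\hat V\,\mathrm{diag}\left\{\|\hat U_j\|_2/\|\hat V_j\|_2\right\}_{j=1}^s$. Moreover, the vector $\mu$ satisfying these conditions is unique if it exists.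
   Context: Data: integers $d,n\ge1$ and a trajectory $(i_0,\dots,i_n)$ of states in $\{1,\dots,d\}$. Put $\hat\xi_j=\frac1n\#\{1\le t\le n: i_t=j\}$ and $\hat\Xi=\mathrm{diag}\{\hat\xi\}\in\mathbb{R}^{d\times d}$. Let $\hat P\in\mathbb{R}^{d\times d}$ be the empirical transition matrix: $\hat p_{ij}=\frac{\#\{1\le t\le n:\ i_{t-1}=i,\ i_t=j\}}{\#\{1\le t\le n:\ i_{t-1}=i\}}$ if the denominator is at least $1$, and $\hat p_{ij}=1/d$ otherwise. Define $g(X)=\frac12\|\hat\Xi(\hat P-X)\|_F^2$ for $X\in\mathbb{R}^{d\times d}$; $\nabla g$ is its gradient. The regularization parameter is $\lambda>0$. $\mathcal{E}=\{X\in\mathbb{R}^{d\times d}: X\mathbf{1}_d=\mathbf{1}_d\}$, and $\chi_{\mathcal{E}}(X)=0$ if $X\in\mathcal{E}$, $+\infty$ otherwise. The atomic regularizer is $\Omega(X)=\inf\left\{\sum_{j=1}^m\|U_j\|_2\|V_j\|_2 : X=UV^T,\ U,V\in\mathbb{R}_+^{d\times m},\ m\ge1\right\}$ ($+\infty$ if no such factorization exists). A factorization $X=UV^T$ with $U,V\in\mathbb{R}_+^{d\times m}$ is called an optimal factorization (with respect to $\Omega$) if $\Omega(X)=\sum_{j=1}^m\|U_j\|_2\|V_j\|_2$. The objective is $f_\lambda(X)=g(X)+\chi_{\mathcal{E}}(X)+\lambda\Omega(X)$. $\mathcal{U}^{d\times s}=\{U\in\mathbb{R}_+^{d\times s}:U\mathbf{1}_s=\mathbf{1}_d\}$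 and $\mathcal{V}^{d\times s}=\{V\in\mathbb{R}_+^{d\times s}:V^T\mathbf{1}_d=\mathbf{1}_s\}$, where $\mathbb{R}_+^{p\times q}$ is the set of entrywise nonnegative matrices. $A_j$ is the $j$-th column of $A$; $[A]_+$ is the entrywise nonnegative part, $([A]_+)_{ij}=\max\{a_{ij},0\}$; $\mathbf{1}_p$ is the all-one vector in $\mathbb{R}^p$; $\mathrm{diag}\{x_j\}_{j=1}^s$ is the diagonal matrix with diagonal $x_1,\dots,x_s$. *)

theory Defs
  imports "HOL-Analysis.Analysis"
begin

text \<open>
  The state space \<open>{1,\<dots>,d}\<close> is a finite type \<open>'d\<close> with \<open>CARD('d) = d\<close>, and a real \<open>p \<times> q\<close> matrix
  has type \<open>real ^ 'q ^ 'p\<close>. On this type \<open>norm\<close> is the Frobenius norm and \<open>inner\<close> the Frobenius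
  inner product. On \<open>real ^ 'p\<close> the constant \<open>1\<close> is the all-one vector.
\<close>

definition outer :: "real ^ 'p \<Rightarrow> real ^ 'q \<Rightarrow> real ^ 'q ^ 'p" where
  "outer x y = (\<chi> a b. x $ a * y $ b)"

definition diag :: "real ^ 'p \<Rightarrow> real ^ 'p ^ 'p" where
  "diag x = (\<chi> a b. if a = b then x $ a else 0)"

definition pos_part :: "real ^ 'q ^ 'p \<Rightarrow> real ^ 'q ^ 'p" where
  "pos_part A = (\<chi> a b. max (A $ a $ b) 0)"

definition nonneg_vec :: "real ^ 'p \<Rightarrow> bool" where
  "nonneg_vec x \<longleftrightarrow> (\<forall>a. 0 \<le> x $ a)"

definition nonneg_mat :: "real ^ 'q ^ 'p \<Rightarrow> bool" where
  "nonneg_mat A \<longleftrightarrow> (\<forall>a b. 0 \<le> A $ a $ b)"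

definition row_stochastic_mats :: "(real ^ 's ^ 'd) set" where
  "row_stochastic_mats = {U. nonneg_mat U \<and> U *v 1 = 1}"

definition col_stochastic_mats :: "(real ^ 's ^ 'd) set" where
  "col_stochastic_mats = {V. nonneg_mat V \<and> transpose V *v 1 = 1}"

definition gradient :: "('a::real_inner \<Rightarrow> real) \<Rightarrow> 'a \<Rightarrow> 'a" where
  "gradient f x = (THE D. GDERIV f x :> D)"

lemma gradient_eqI:
  assumes "GDERIV f x :> D"
  shows "gradient f x = D"
  unfolding gradient_def
proof (rule the_equality[where P = "\<lambda>D. GDERIV f x :> D", OF assms])
  fix E assume "GDERIV f x :> E"
  with assms have "(\<lambda>h. inner h E) = (\<lambda>h. inner h D)"
    unfolding gderiv_def by (rule has_derivative_unique[rotated])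
  then have "inner (E - D) (E - D) = 0"
    by (metis cancel_comm_monoid_add_class.diff_cancel inner_diff_right)
  then show "E = D" by simp
qed

text \<open>A trajectory \<open>(i\<^sub>0,\<dots>,i\<^sub>n)\<close> is a function \<open>tr\<close> on \<open>nat\<close> of which only the values at
  \<open>0,\<dots>,n\<close> are used.\<close>

definition emp_freq :: "nat \<Rightarrow> (nat \<Rightarrow> 'd) \<Rightarrow> real ^ 'd" where
  "emp_freq n tr = (\<chi> j. real (card {t \<in> {1..n}. tr t = j}) / real n)"

definition emp_trans :: "nat \<Rightarrow> (nat \<Rightarrow> 'd) \<Rightarrow> real ^ 'd ^ 'd" where
  "emp_trans n tr = (\<chi> i j.
     if card {t \<in> {1..n}. tr (t - 1) = i} \<ge> 1
     then real (card {t \<in> {1..n}. tr (t - 1) = i \<and> tr t = j}) / real (card {t \<in> {1..n}. tr (t - 1) = i})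
     else 1 / real CARD('d))"

definition g_loss :: "nat \<Rightarrow> (nat \<Rightarrow> 'd) \<Rightarrow> real ^ 'd ^ 'd \<Rightarrow> real" where
  "g_loss n tr X = 1 / 2 * (norm (diag (emp_freq n tr) ** (emp_trans n tr - X)))\<^sup>2"

definition row_sum_one :: "(real ^ 'd ^ 'd) set" where
  "row_sum_one = {X. X *v 1 = 1}"

definition chi_E :: "real ^ 'd ^ 'd \<Rightarrow> ereal" where
  "chi_E X = (if X \<in> row_sum_one then 0 else \<infinity>)"

text \<open>The inner dimension \<open>m\<close> ranges over all positive integers inside the infimum, so here the
  factors are given by their columns \<open>U 1, \<dots>, U m\<close> and \<open>V 1, \<dots>, V m\<close>, and \<open>U V\<^sup>T\<close> is the sum of
  the matrices \<open>U j (V j)\<^sup>T\<close>. The infimum of the empty set is \<open>\<infinity>\<close>.\<close>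

definition Omega :: "real ^ 'd ^ 'd \<Rightarrow> ereal" where
  "Omega X = Inf {ereal (\<Sum>j=1..m. norm (U j) * norm (V j)) |
       (m::nat) (U :: nat \<Rightarrow> real ^ 'd) (V :: nat \<Rightarrow> real ^ 'd).
       m \<ge> 1 \<and> (\<forall>j\<in>{1..m}. nonneg_vec (U j) \<and> nonneg_vec (V j)) \<and>
       X = (\<Sum>j=1..m. outer (U j) (V j))}"

definition optimal_factorization ::
    "real ^ 'd ^ 'd \<Rightarrow> real ^ 's ^ 'd \<Rightarrow> real ^ 's ^ 'd \<Rightarrow> bool" where
  "optimal_factorization X U V \<longleftrightarrow>
     nonneg_mat U \<and> nonneg_mat V \<and> X = U ** transpose V \<and>
     Omega X = ereal (\<Sum>j\<in>UNIV. norm (column j U) * norm (column j V))"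

definition f_obj :: "nat \<Rightarrow> (nat \<Rightarrow> 'd) \<Rightarrow> real \<Rightarrow> real ^ 'd ^ 'd \<Rightarrow> ereal" where
  "f_obj n tr lam X = ereal (g_loss n tr X) + chi_E X + ereal lam * Omega X"

definition global_minimizer :: "('a \<Rightarrow> ereal) \<Rightarrow> 'a \<Rightarrow> bool" where
  "global_minimizer f x \<longleftrightarrow> (\<forall>y. f x \<le> f y)"

definition optimality_conditions ::
    "real ^ 'd ^ 'd \<Rightarrow> real \<Rightarrow> real ^ 's ^ 'd \<Rightarrow> real ^ 's ^ 'd \<Rightarrow> real ^ 'd \<Rightarrow> bool" where
  "optimality_conditions G lam U V \<mu> \<longleftrightarrow>
     (\<forall>u v. nonneg_vec u \<and> nonneg_vec v \<and> norm u = 1 \<and> norm v = 1 \<longrightarrow>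
        u \<bullet> ((outer \<mu> 1 - G) *v v) \<le> lam) \<and>
     pos_part (outer \<mu> 1 - G ** V)
       = lam *\<^sub>R (U ** diag (\<chi> j. norm (column j V) / norm (column j U))) \<and>
     pos_part (outer 1 \<mu> ** U - transpose G ** U)
       = lam *\<^sub>R (V ** diag (\<chi> j. norm (column j U) / norm (column j V)))"

end

theory Submission
  imports Defs
begin

text \<open>
  Put \<open>W = \<mu> 1\<^sup>T - \<nabla>g(X)\<close>. Condition (a) says that \<open>\<langle>W, Y\<rangle> \<le> \<lambda> \<Omega>(Y)\<close> for all \<open>Y\<close>, and (b), as well as
  (c), forces \<open>\<langle>W, X\<rangle> = \<lambda> \<Sum>\<^sub>j \<parallel>U\<^sub>j\<parallel> \<parallel>V\<^sub>j\<parallel>\<close>. As \<open>W\<close> and \<open>-\<nabla>g(X)\<close> agree on differences of matrices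
  with unit row sums, convexity of \<open>g\<close> makes \<open>X\<close> a minimizer. Conversely, minimality keeps the origin
  out of the convex set of pairs \<open>(Y 1 - 1, t)\<close> with \<open>t > \<langle>\<nabla>g(X), Y - X\<rangle> + \<lambda> (c - \<Omega>(X))\<close>, where \<open>c\<close> is the
  cost of a nonnegative factorization of \<open>Y\<close>. A separating hyperplane is not vertical, since the row
  sums \<open>Y 1\<close> fill the nonnegative orthant, and its slope is the multiplier \<open>\<mu>\<close>. Positive homogeneity gives
  (a) and equality on every pair \<open>(U\<^sub>j, V\<^sub>j)\<close>, and (b), (c) are the equality case of Cauchy-Schwarz.
\<close>

section \<open>Outer products, columns and stochastic factors\<close>

lemma inner_outer: "outer u v \<bullet> W = u \<bullet> (W *v v)"
  by (simp add: inner_vec_def outer_def matrix_vector_mult_def sum_distrib_left mult_ac)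

lemma outer_scaleR_left: "outer (c *\<^sub>R u) v = c *\<^sub>R outer u v"
  by (simp add: outer_def vec_eq_iff)

lemma outer_zero_left [simp]: "outer 0 v = 0"
  by (simp add: outer_def vec_eq_iff)

lemma outer_mult_vec: "outer u v *v w = (v \<bullet> w) *\<^sub>R u"
  by (simp add: vec_eq_iff outer_def matrix_vector_mult_def inner_vec_def sum_distrib_right
      sum_distrib_left mult_ac)

lemma transpose_outer: "transpose (outer u v) = outer v u"
  by (simp add: outer_def transpose_def vec_eq_iff)

lemma transpose_diff: "transpose (A - B) = transpose A - transpose (B :: real ^ 'q ^ 'p)"
  by (simp add: transpose_def vec_eq_iff)

lemma matrix_mult_transpose_eq_sum_outer:
  fixes U :: "real ^ 's::finite ^ 'p" and V :: "real ^ 's ^ 'q"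
  shows "U ** transpose V = (\<Sum>j\<in>UNIV. outer (column j U) (column j V))"
  by (simp add: vec_eq_iff matrix_matrix_mult_def transpose_def outer_def column_def)

lemma matrix_mult_nth_column: "(A ** B) $ a $ j = (A *v column j B) $ a"
  by (simp add: matrix_matrix_mult_def matrix_vector_mult_def column_def)

lemma matrix_mult_diag_nth: "(A ** diag x) $ a $ j = A $ a $ j * x $ j"
  by (simp add: matrix_matrix_mult_def diag_def if_distrib cong: if_cong)

lemma nonneg_vec_column: "nonneg_mat A \<Longrightarrow> nonneg_vec (column j A)"
  by (simp add: nonneg_mat_def nonneg_vec_def column_def)

lemma inner_one_column: "V \<in> col_stochastic_mats \<Longrightarrow> 1 \<bullet> column j V = 1"
  by (simp add: col_stochastic_mats_def vec_eq_iff matrix_vector_mult_def inner_vec_def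
      column_def transpose_def)

lemma column_col_stochastic_nonzero:
  "V \<in> col_stochastic_mats \<Longrightarrow> column j V \<noteq> 0"
  using inner_one_column[of V j] by auto

lemma row_sum_one_mult_transpose:
  assumes "U \<in> row_stochastic_mats" "V \<in> col_stochastic_mats"
  shows "(U ** transpose V) *v 1 = 1"
  using assms
  by (simp add: row_stochastic_mats_def col_stochastic_mats_def matrix_vector_mul_assoc[symmetric])

section \<open>Gradient and exact expansion of the quadratic loss\<close>

lemma GDERIV_half_norm_linear_sq:
  fixes A :: "'a::euclidean_space \<Rightarrow> 'b::euclidean_space"
  assumes "linear A"
  shows "GDERIV (\<lambda>Z. 1 / 2 * (norm (A (P - Z)))\<^sup>2) X :> - adjoint A (A (P - X))"
proof -
  have bl: "bounded_linear A"
    using assms by (rule linear_conv_bounded_linear[THEN iffD1])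
  show ?thesis
    unfolding gderiv_def power2_norm_eq_inner
    by (auto intro!: derivative_eq_intros bounded_linear.has_derivative[OF bl]
        simp: adjoint_works[OF assms] linear_neg[OF assms] inner_commute)
qed

lemma half_norm_linear_sq_expand:
  fixes A :: "'a::euclidean_space \<Rightarrow> 'b::euclidean_space"
  assumes "linear A"
  shows "1 / 2 * (norm (A (P - Y)))\<^sup>2 = 1 / 2 * (norm (A (P - X)))\<^sup>2
    + (- adjoint A (A (P - X))) \<bullet> (Y - X) + 1 / 2 * (norm (A (Y - X)))\<^sup>2"
proof -
  have "A (P - Y) = A (P - X) - A (Y - X)"
    by (simp add: linear_diff[OF assms, symmetric])
  then have "norm (A (P - Y))^2 = norm (A (P - X))^2 - 2 * (A (P - X) \<bullet> A (Y - X)) + norm (A (Y - X))^2"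
    by (simp add: power2_norm_eq_inner inner_diff_left inner_diff_right inner_commute)
  moreover have "adjoint A (A (P - X)) \<bullet> (Y - X) = A (P - X) \<bullet> A (Y - X)"
    by (rule adjoint_clauses(2)[OF assms])
  ultimately show ?thesis by simp
qed

text \<open>A quadratic equals its second-order Taylor polynomial. At \<open>t = 1\<close> the
  nonnegative last term yields the gradient inequality of a convex function; for small
  \<open>t\<close> it is negligible against the linear term.\<close>

lemma g_loss_expand:
  fixes X H :: "real ^ 'd::finite ^ 'd"
  shows "g_loss n tr (X + t *\<^sub>R H) = g_loss n tr X + t * (gradient (g_loss n tr) X \<bullet> H)
    + t\<^sup>2 * (1 / 2 * (norm (diag (emp_freq n tr) ** H))\<^sup>2)"
proof -
  define A where "A = (\<lambda>Z :: real ^ 'd ^ 'd. diag (emp_freq n tr) ** Z)"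
  have lin: "linear A"
    unfolding A_def
    by (intro linearI) (simp_all add: matrix_add_ldistrib vec_eq_iff matrix_matrix_mult_def
        sum_distrib_left mult_ac distrib_left sum.distrib)
  have g: "g_loss n tr = (\<lambda>Z. 1 / 2 * (norm (A (emp_trans n tr - Z)))\<^sup>2)"
    by (simp add: A_def g_loss_def fun_eq_iff)
  show ?thesis
    unfolding gradient_eqI[OF GDERIV_half_norm_linear_sq[OF lin, of "emp_trans n tr" X], folded g]
    using half_norm_linear_sq_expand[OF lin, of "emp_trans n tr" "X + t *\<^sub>R H" X]
    \<comment> \<open>\<open>A\<close> stays folded until linearity has pulled \<open>t\<close> out
      of the norm.\<close>
    by (simp add: g linear_scale[OF lin] power_mult_distrib) (simp add: A_def)
qed

section \<open>Costs of nonnegative factorizations\<close>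

definition factor_cost :: "real ^ 'd ^ 'd \<Rightarrow> real \<Rightarrow> bool" where
  "factor_cost X c \<longleftrightarrow> (\<exists>(m::nat) (U :: nat \<Rightarrow> real ^ 'd) (V :: nat \<Rightarrow> real ^ 'd).
     c = (\<Sum>j=1..m. norm (U j) * norm (V j)) \<and>
     m \<ge> 1 \<and> (\<forall>j\<in>{1..m}. nonneg_vec (U j) \<and> nonneg_vec (V j)) \<and>
     X = (\<Sum>j=1..m. outer (U j) (V j)))"

lemma factor_costI:
  fixes U V :: "nat \<Rightarrow> real ^ 'd"
  shows "m \<ge> 1 \<Longrightarrow> \<forall>j\<in>{1..m}. nonneg_vec (U j) \<and> nonneg_vec (V j) \<Longrightarrow>
    factor_cost (\<Sum>j=1..m. outer (U j) (V j)) (\<Sum>j=1..m. norm (U j) * norm (V j))"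
  unfolding factor_cost_def
  by (rule exI[of _ m], rule exI[of _ U], rule exI[of _ V]) simp

lemma factor_costE:
  assumes "factor_cost X c"
  obtains m :: nat and U V where "c = (\<Sum>j=1..m. norm (U j) * norm (V j))" "m \<ge> 1"
    "\<forall>j\<in>{1..m}. nonneg_vec (U j) \<and> nonneg_vec (V j)" "X = (\<Sum>j=1..m. outer (U j) (V j))"
  using assms unfolding factor_cost_def by (elim exE conjE) (rule that)

text \<open>Reduces claims about \<open>Omega\<close> to real costs \<open>c\<close> of single
  factorizations, so that convexity arguments need neither infima nor \<open>ereal\<close>.\<close>

lemma Omega_eq_Inf_factor_cost: "Omega X = Inf {ereal c | c. factor_cost X c}"
  unfolding Omega_def factor_cost_def by (rule arg_cong[where f = Inf]) blast

lemma Omega_le: "factor_cost X c \<Longrightarrow> Omega X \<le> ereal c"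
  unfolding Omega_eq_Inf_factor_cost by (rule Inf_lower) blast

lemma Omega_ge: "(\<And>c. factor_cost X c \<Longrightarrow> b \<le> c) \<Longrightarrow> ereal b \<le> Omega X"
  unfolding Omega_eq_Inf_factor_cost by (rule Inf_greatest) auto

lemma factor_cost_outer:
  "nonneg_vec u \<Longrightarrow> nonneg_vec v \<Longrightarrow> factor_cost (outer u v) (norm u * norm v)"
  using factor_costI[of 1 "\<lambda>_. u" "\<lambda>_. v"] by (simp del: sum_constant)

lemma factor_cost_zero: "factor_cost (0 :: real ^ 'd::finite ^ 'd) 0"
  using factor_cost_outer[of "0 :: real ^ 'd" 0] by (simp add: nonneg_vec_def)

text \<open>Two factorizations are concatenated. Together with scaling this makes the pairs of a
  matrix and a cost a convex cone.\<close>

lemma factor_cost_add: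
  fixes X Y :: "real ^ 'd::finite ^ 'd"
  assumes "factor_cost X c" "factor_cost Y d"
  shows "factor_cost (X + Y) (c + d)"
proof -
  obtain m :: nat and U V :: "nat \<Rightarrow> real ^ 'd" where 1: "c = (\<Sum>j=1..m. norm (U j) * norm (V j))" "m \<ge> 1"
    "\<forall>j\<in>{1..m}. nonneg_vec (U j) \<and> nonneg_vec (V j)" "X = (\<Sum>j=1..m. outer (U j) (V j))"
    using assms(1) by (rule factor_costE)
  obtain m' :: nat and U' V' :: "nat \<Rightarrow> real ^ 'd" where 2: "d = (\<Sum>j=1..m'. norm (U' j) * norm (V' j))" "m' \<ge> 1"
    "\<forall>j\<in>{1..m'}. nonneg_vec (U' j) \<and> nonneg_vec (V' j)" "Y = (\<Sum>j=1..m'. outer (U' j) (V' j))"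
    using assms(2) by (rule factor_costE)
  \<comment> \<open>Indices above \<open>m\<close> are shifted back by \<open>m\<close>, so index
    \<open>m + 1\<close> carries the first column of the second factorization.\<close>
  define A B where "A j = (if j \<le> m then U j else U' (j - m))"
    and "B j = (if j \<le> m then V j else V' (j - m))" for j
  \<comment> \<open>A generic \<open>h\<close> serves both the sum of norm products and the sum of
    outer products.\<close>
  have split: "(\<Sum>j=1..m+m'. h (A j) (B j)) = (\<Sum>j=1..m. h (U j) (V j)) + (\<Sum>j=1..m'. h (U' j) (V' j))"
    for h :: "real ^ 'd \<Rightarrow> real ^ 'd \<Rightarrow> 'z::comm_monoid_add"
  proof -
    have "(\<Sum>j=m+1..m+m'. h (A j) (B j)) = (\<Sum>j=1..m'. h (A (j + m)) (B (j + m)))"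
      using sum.shift_bounds_cl_nat_ivl[of "\<lambda>j. h (A j) (B j)" 1 m m'] by (simp add: add.commute)
    also have "\<dots> = (\<Sum>j=1..m'. h (U' j) (V' j))"
      by (rule sum.cong) (auto simp: A_def B_def)
    finally show ?thesis
      using sum.ub_add_nat[of 1 m "\<lambda>j. h (A j) (B j)" m']
      by (simp add: A_def B_def)
  qed
  have "\<forall>j\<in>{1..m+m'}. nonneg_vec (A j) \<and> nonneg_vec (B j)"
  proof
    fix j assume "j \<in> {1..m+m'}"
    then have "j \<in> {1..m} \<or> \<not> j \<le> m \<and> j - m \<in> {1..m'}" by auto
    then show "nonneg_vec (A j) \<and> nonneg_vec (B j)"
      using 1(3) 2(3) by (auto simp: A_def B_def)
  qed
  then have "factor_cost (\<Sum>j=1..m+m'. outer (A j) (B j)) (\<Sum>j=1..m+m'. norm (A j) * norm (B j))"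
    using 1(2) by (intro factor_costI) auto
  then show ?thesis
    using split[of "\<lambda>u v. norm u * norm v"] split[of outer] by (simp add: 1(1,4) 2(1,4))
qed

text \<open>Only the left columns are multiplied by \<open>r\<close>, so the cost grows by
  \<open>r\<close> and not by its square.\<close>

lemma factor_cost_scaleR:
  fixes X :: "real ^ 'd::finite ^ 'd"
  assumes "factor_cost X c" "0 \<le> r"
  shows "factor_cost (r *\<^sub>R X) (r * c)"
proof -
  obtain m :: nat and U V :: "nat \<Rightarrow> real ^ 'd" where 1: "c = (\<Sum>j=1..m. norm (U j) * norm (V j))" "m \<ge> 1"
    "\<forall>j\<in>{1..m}. nonneg_vec (U j) \<and> nonneg_vec (V j)" "X = (\<Sum>j=1..m. outer (U j) (V j))"
    using assms(1) by (rule factor_costE)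
  have "factor_cost (\<Sum>j=1..m. outer (r *\<^sub>R U j) (V j)) (\<Sum>j=1..m. norm (r *\<^sub>R U j) * norm (V j))"
    using 1(2,3) assms(2) by (intro factor_costI) (auto simp: nonneg_vec_def)
  then show ?thesis
    using assms(2) by (simp add: 1(1,4) sum_distrib_left scaleR_sum_right outer_scaleR_left mult.assoc)
qed

lemma factor_cost_sum:
  assumes "finite I" "\<And>i. i \<in> I \<Longrightarrow> factor_cost (F i) (c i)"
  shows "factor_cost (sum F I) (sum c I)"
  using assms by (induction I rule: finite_induct) (auto intro: factor_cost_zero factor_cost_add)

text \<open>Weak duality: pairing \<open>W\<close> with \<open>outer u v\<close> gives the bilinear
  form, so a bound on rank-one terms adds up over any factorization.\<close>

lemma inner_le_factor_cost:
  fixes W Y :: "real ^ 'd::finite ^ 'd"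
  assumes bound: "\<And>u v. nonneg_vec u \<Longrightarrow> nonneg_vec v \<Longrightarrow> u \<bullet> (W *v v) \<le> l * (norm u * norm v)"
    and "factor_cost Y c"
  shows "W \<bullet> Y \<le> l * c"
proof -
  obtain m :: nat and U V :: "nat \<Rightarrow> real ^ 'd" where 1: "c = (\<Sum>j=1..m. norm (U j) * norm (V j))" "m \<ge> 1"
    "\<forall>j\<in>{1..m}. nonneg_vec (U j) \<and> nonneg_vec (V j)" "Y = (\<Sum>j=1..m. outer (U j) (V j))"
    using assms(2) by (rule factor_costE)
  have "W \<bullet> Y = (\<Sum>j=1..m. U j \<bullet> (W *v V j))"
    by (simp add: 1 inner_sum_right inner_commute[of W] inner_outer)
  also have "\<dots> \<le> (\<Sum>j=1..m. l * (norm (U j) * norm (V j)))"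
    using 1(3) by (intro sum_mono bound) auto
  finally show ?thesis by (simp add: 1 sum_distrib_left)
qed

section \<open>The bilinear bound on nonnegative vectors and its equality case\<close>

lemma bilinear_bound_homogeneous:
  assumes "\<forall>u v. nonneg_vec u \<and> nonneg_vec v \<and> norm u = 1 \<and> norm v = 1 \<longrightarrow> u \<bullet> (W *v v) \<le> l"
    and "nonneg_vec u" "nonneg_vec v"
  shows "u \<bullet> (W *v v) \<le> l * (norm u * norm v)"
proof (cases "u = 0 \<or> v = 0")
  case False
  define u' v' where "u' = (1 / norm u) *\<^sub>R u" and "v' = (1 / norm v) *\<^sub>R v"
  have "u' \<bullet> (W *v v') \<le> l"
    using assms(2,3) False by (intro assms(1)[rule_format]) (auto simp: u'_def v'_def nonneg_vec_def)
  moreover have "u \<bullet> (W *v v) = (norm u * norm v) * (u' \<bullet> (W *v v'))"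
    using False by (simp add: u'_def v'_def matrix_vector_mult_scaleR)
  ultimately show ?thesis
    by (metis mult.commute mult_left_mono mult_nonneg_nonneg norm_ge_zero)
qed auto

text \<open>Let \<open>p\<close> be the positive part of \<open>w\<close>. Testing the bound at
  \<open>p\<close> gives \<open>norm p \<le> r\<close>, while
  \<open>r * norm x = x \<bullet> w \<le> x \<bullet> p\<close>. Thus \<open>x\<close> and
  \<open>p\<close> attain Cauchy-Schwarz, which forces \<open>p\<close> to be the stated multiple of
  \<open>x\<close>.\<close>

lemma max_zero_eq_of_inner_attained:
  fixes w x :: "real ^ 'p::finite"
  assumes bound: "\<And>u. nonneg_vec u \<Longrightarrow> u \<bullet> w \<le> r * norm u"
    and "x \<noteq> 0" "nonneg_vec x" "0 \<le> r" and eq: "x \<bullet> w = r * norm x"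
  shows "max (w $ a) 0 = r / norm x * x $ a"
proof -
  define p :: "real ^ 'p" where "p = (\<chi> a. max (w $ a) 0)"
  define k where "k = r / norm x"
  have pw: "p \<bullet> w = p \<bullet> p"
    unfolding inner_vec_def by (rule sum.cong) (auto simp: p_def max_def)
  have "nonneg_vec p"
    by (simp add: nonneg_vec_def p_def)
  then have "norm p * norm p \<le> r * norm p"
    using bound[of p] by (simp add: pw flip: power2_norm_eq_inner power2_eq_square)
  then have "norm p \<le> r"
    using \<open>0 \<le> r\<close> by (cases "p = 0") auto
  then have pp: "p \<bullet> p \<le> r * r"
    by (simp add: mult_mono \<open>0 \<le> r\<close> power2_eq_square flip: power2_norm_eq_inner)
  have xp: "x \<bullet> w \<le> x \<bullet> p"
    unfolding inner_vec_def
    using assms(3) by (intro sum_mono) (auto simp: p_def nonneg_vec_def intro!: mult_left_mono)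
  \<comment> \<open>The squared distance from \<open>p\<close> to its claimed value is at most
    \<open>r * r - 2 * (r * r) + r * r = 0\<close>.\<close>
  have "(p - k *\<^sub>R x) \<bullet> (p - k *\<^sub>R x) = p \<bullet> p - 2 * k * (x \<bullet> p) + k * k * (x \<bullet> x)"
    by (simp add: inner_diff_left inner_diff_right inner_commute)
  also have "k * k * (x \<bullet> x) = r * r"
    using assms(2) by (simp add: k_def power2_eq_square flip: power2_norm_eq_inner)
  finally have "(p - k *\<^sub>R x) \<bullet> (p - k *\<^sub>R x) = p \<bullet> p - 2 * k * (x \<bullet> p) + r * r" .
  moreover have "2 * k * (r * norm x) \<le> 2 * k * (x \<bullet> p)"
    using xp eq assms(4) by (intro mult_left_mono) (auto simp: k_def)
  moreover have "2 * k * (r * norm x) = 2 * (r * r)"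
    using assms(2) by (simp add: k_def)
  ultimately have "(p - k *\<^sub>R x) \<bullet> (p - k *\<^sub>R x) \<le> 0"
    using pp by linarith
  then have "p - k *\<^sub>R x = 0"
    by (meson inner_gt_zero_iff not_le)
  then have "p $ a = k * x $ a" by simp
  then show ?thesis by (simp add: p_def k_def)
qed

text \<open>On the support of \<open>x\<close> the prescribed positive part is positive, hence
  equals \<open>w\<close> there; off the support the entries do not enter the inner product.\<close>

lemma inner_eq_of_max_zero_eq:
  fixes w x :: "real ^ 'p::finite"
  assumes "x \<noteq> 0" "nonneg_vec x" "0 < r" and "\<And>a. max (w $ a) 0 = r / norm x * x $ a"
  shows "x \<bullet> w = r * norm x"
proof -
  have "x $ a * w $ a = r / norm x * (x $ a * x $ a)" for a
  proof (cases "x $ a = 0")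
    case False
    then have "0 < r / norm x * x $ a"
      using assms(1,2,3) by (simp add: nonneg_vec_def order.not_eq_order_implies_strict)
    then have "w $ a = r / norm x * x $ a"
      using assms(4)[of a] by linarith
    then show ?thesis by simp
  qed simp
  then have "x \<bullet> w = r / norm x * (x \<bullet> x)"
    by (simp add: inner_vec_def sum_distrib_left)
  then show ?thesis
    using assms(1) by (simp add: power2_eq_square flip: power2_norm_eq_inner)
qed

text \<open>Expresses all three conditions through the one matrix \<open>W \<mu>\<close>. In (b) the
  vector \<open>1\<close> has length \<open>s\<close>, in \<open>W \<mu>\<close> length
  \<open>d\<close>; the two agree on the columns of \<open>V\<close> because these sum to
  one.\<close>

lemma optimality_conditions_columnwise:
  fixes U V :: "real ^ 's::finite ^ 'd::finite" and G :: "real ^ 'd ^ 'd"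
  assumes "V \<in> col_stochastic_mats"
  defines "W \<equiv> \<lambda>\<mu>. outer \<mu> 1 - G"
  shows "optimality_conditions G l U V \<mu> \<longleftrightarrow>
    (\<forall>u v. nonneg_vec u \<and> nonneg_vec v \<and> norm u = 1 \<and> norm v = 1 \<longrightarrow> u \<bullet> (W \<mu> *v v) \<le> l) \<and>
    (\<forall>j a. max ((W \<mu> *v column j V) $ a) 0
       = l * norm (column j V) / norm (column j U) * column j U $ a) \<and>
    (\<forall>j a. max ((transpose (W \<mu>) *v column j U) $ a) 0
       = l * norm (column j U) / norm (column j V) * column j V $ a)"
proof -
  have b: "(outer \<mu> 1 - G ** V) $ a $ j = (W \<mu> *v column j V) $ a" for a j
    by (simp add: W_def matrix_vector_mult_diff_rdistrib outer_mult_vec inner_one_column assms(1)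
        matrix_mult_nth_column) (simp add: outer_def)
  have c: "(outer 1 \<mu> ** U - transpose G ** U) $ a $ j = (transpose (W \<mu>) *v column j U) $ a" for a j
    by (simp add: W_def matrix_vector_mult_diff_rdistrib transpose_diff transpose_outer
        matrix_mult_nth_column)
  have "pos_part (outer \<mu> 1 - G ** V) = l *\<^sub>R (U ** diag (\<chi> j. norm (column j V) / norm (column j U)))
    \<longleftrightarrow> (\<forall>a j. max ((W \<mu> *v column j V) $ a) 0
       = l * norm (column j V) / norm (column j U) * column j U $ a)"
    unfolding vec_eq_iff pos_part_def vec_lambda_beta b
    by (simp add: matrix_mult_diag_nth column_def mult_ac)
  moreover have "pos_part (outer 1 \<mu> ** U - transpose G ** U)
      = l *\<^sub>R (V ** diag (\<chi> j. norm (column j U) / norm (column j V)))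
    \<longleftrightarrow> (\<forall>a j. max ((transpose (W \<mu>) *v column j U) $ a) 0
       = l * norm (column j U) / norm (column j V) * column j V $ a)"
    unfolding vec_eq_iff pos_part_def vec_lambda_beta c
    by (simp add: matrix_mult_diag_nth column_def mult_ac)
  ultimately show ?thesis
    unfolding optimality_conditions_def W_def by blast
qed

section \<open>The Lagrange multiplier of the row-sum constraint\<close>

lemma exists_row_sum_multiplier:
  fixes G X :: "real ^ 'd::finite ^ 'd"
  assumes X1: "X *v 1 = 1"
    and min: "\<And>Y c. factor_cost Y c \<Longrightarrow> Y *v 1 = 1 \<Longrightarrow> 0 \<le> G \<bullet> (Y - X) + l * (c - w)"
  obtains \<mu> where "\<And>Y c. factor_cost Y c \<Longrightarrow> (outer \<mu> 1 - G) \<bullet> (Y - X) \<le> l * (c - w)"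
proof -
  \<comment> \<open>\<open>q\<close> is jointly affine in \<open>Y\<close> and \<open>c\<close>, so
    convexity of \<open>C\<close> comes from the cone of factor costs. The hypothesis
    \<open>min\<close> says that \<open>q\<close> is nonnegative wherever the row-sum residual
    vanishes.\<close>
  define q where "q Y c = G \<bullet> (Y - X) + l * (c - w)" for Y c
  define C :: "((real ^ 'd) \<times> real) set"
    where "C = {(Y *v 1 - 1, s) | Y c s. factor_cost Y c \<and> q Y c < s}"
  have "convex C"
  proof (rule convexI)
    fix z z' and u v :: real
    assume "z \<in> C" "z' \<in> C" and uv: "0 \<le> u" "0 \<le> v" "u + v = 1"
    then obtain Y c s Y' c' s' where z: "z = (Y *v 1 - 1, s)" "factor_cost Y c" "q Y c < s"
      and z': "z' = (Y' *v 1 - 1, s')" "factor_cost Y' c'" "q Y' c' < s'"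
      unfolding C_def by blast
    define Z d where "Z = u *\<^sub>R Y + v *\<^sub>R Y'" and "d = u * c + v * c'"
    have v: "v = 1 - u" using uv by simp
    have "factor_cost Z d"
      unfolding Z_def d_def using uv z z' by (intro factor_cost_add factor_cost_scaleR)
    moreover have "q Z d = u * q Y c + v * q Y' c'"
      by (simp add: q_def Z_def d_def v algebra_simps)
    \<comment> \<open>The strict inequality comes from the first point if \<open>u > 0\<close>, and
      from the second if \<open>u = 0\<close>, where \<open>v = 1\<close>.\<close>
    moreover have "u * q Y c + v * q Y' c' < u * s + v * s'"
    proof (cases "u = 0")
      case False
      then show ?thesis
        using uv z z' by (intro add_less_le_mono mult_strict_left_mono mult_left_mono) auto
    qed (use uv z' in simp)
    moreover have "u *\<^sub>R z + v *\<^sub>R z' = (Z *v 1 - 1, u * s + v * s')"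
      by (simp add: z z' Z_def v scaleR_matrix_vector_assoc[symmetric] algebra_simps)
    ultimately show "u *\<^sub>R z + v *\<^sub>R z' \<in> C"
      unfolding C_def mem_Collect_eq by (intro exI[of _ Z] exI[of _ d] exI conjI) auto
  qed
  moreover have "0 \<notin> C"
  proof
    assume "0 \<in> C"
    then obtain Y c where "Y *v 1 = 1" "factor_cost Y c" "q Y c < 0"
      by (auto simp: C_def zero_prod_def)
    then show False using min[of Y c] by (simp add: q_def)
  qed
  ultimately obtain ab where ab: "ab \<noteq> 0" "\<forall>z\<in>C. 0 \<le> ab \<bullet> z"
    using separating_hyperplane_set_0 by blast
  obtain a b where "ab = (a, b)" by (cases ab)
  with ab(2) have sep: "0 \<le> a \<bullet> (Y *v 1 - 1) + b * s" if "factor_cost Y c" "q Y c < s" for Y c s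
    using that by (force simp: C_def)
  have "0 \<le> b"
  proof (rule ccontr)
    assume "\<not> 0 \<le> b"
    then have b: "b < 0" by simp
    \<comment> \<open>At \<open>Y = 0\<close> the residual is \<open>-1\<close>. The first bound
      puts the point into \<open>C\<close>; the second makes its pairing with \<open>(a, b)\<close>
      at most \<open>b < 0\<close>.\<close>
    define s where "s = max (q 0 0 + 1) ((a \<bullet> 1) / b + 1)"
    have "0 \<le> a \<bullet> ((0 :: real ^ 'd ^ 'd) *v 1 - 1) + b * s"
      by (rule sep[OF factor_cost_zero]) (simp add: s_def less_max_iff_disj)
    moreover have "b * s \<le> b * ((a \<bullet> 1) / b + 1)"
      using b by (intro mult_left_mono_neg) (auto simp: s_def)
    moreover have "b * ((a \<bullet> 1) / b + 1) = a \<bullet> 1 + b"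
      using b by (simp add: field_simps)
    ultimately show False using b by simp
  qed
  moreover have "b \<noteq> 0"
  proof
    assume b: "b = 0"
    \<comment> \<open>\<open>r\<close> is nonnegative, and \<open>Y\<close> below has row sums
      \<open>r\<close>, hence residual \<open>- sgn\<close> of \<open>a\<close>. Its pairing with
      \<open>a\<close> is minus the sum of absolute entries, so a vertical hyperplane would have
      \<open>a = 0\<close>.\<close>
    define r :: "real ^ 'd" where "r = (\<chi> i. 1 - sgn (a $ i))"
    define Y where "Y = outer ((1 / real CARD('d)) *\<^sub>R r) (1 :: real ^ 'd)"
    define c where "c = norm ((1 / real CARD('d)) *\<^sub>R r) * norm (1 :: real ^ 'd)"
    have "factor_cost Y c"
      unfolding c_def Y_def by (intro factor_cost_outer) (auto simp: nonneg_vec_def r_def sgn_real_def)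
    from sep[OF this, of "q Y c + 1"] have "0 \<le> a \<bullet> (Y *v 1 - 1)"
      by (simp add: b)
    also have "Y *v 1 - 1 = (\<chi> i. - sgn (a $ i))"
      by (simp add: Y_def outer_mult_vec inner_vec_def r_def vec_eq_iff)
    also have "a \<bullet> \<dots> = - (\<Sum>i\<in>UNIV. \<bar>a $ i\<bar>)"
      by (simp add: inner_vec_def sum_negf abs_sgn)
    finally have "(\<Sum>i\<in>UNIV. \<bar>a $ i\<bar>) = 0"
      by (simp add: antisym sum_nonneg)
    then have "a = 0" by (simp add: sum_nonneg_eq_0_iff vec_eq_iff)
    then show False using ab(1) b \<open>ab = (a, b)\<close> by (simp add: zero_prod_def)
  qed
  ultimately have b: "0 < b" by simp
  \<comment> \<open>The strict bound on \<open>s\<close> is relaxed by letting \<open>s\<close>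
    decrease to \<open>q Y c\<close>.\<close>
  have sep_le: "0 \<le> a \<bullet> (Y *v 1 - 1) + b * q Y c" if "factor_cost Y c" for Y c
  proof (rule field_le_epsilon)
    fix e :: real assume "0 < e"
    then show "0 \<le> a \<bullet> (Y *v 1 - 1) + b * q Y c + e"
      using sep[OF that, of "q Y c + e / b"] b by (simp add: distrib_left add.assoc)
  qed
  show thesis
  \<comment> \<open>Dividing by \<open>b\<close> normalizes the hyperplane; its slope with reversed
    sign is the multiplier.\<close>
  proof (rule that[of "- (1 / b) *\<^sub>R a"])
    fix Y :: "real ^ 'd ^ 'd" and c assume "factor_cost Y c"
    from sep_le[OF this] have "0 \<le> (a \<bullet> (Y *v 1 - 1)) / b + q Y c"
      using b by (simp add: field_simps)
    moreover have "(Y - X) *v 1 = Y *v 1 - 1"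
      by (simp add: matrix_vector_mult_diff_rdistrib X1)
    ultimately show "(outer (- (1 / b) *\<^sub>R a) 1 - G) \<bullet> (Y - X) \<le> l * (c - w)"
      by (simp add: inner_diff_left[of "outer _ _"] inner_outer q_def)
  qed
qed

text \<open>Divide by \<open>t\<close> and let \<open>t\<close> tend to zero from the right.\<close>

lemma linear_coeff_nonneg:
  fixes s K :: real
  assumes "\<And>t. 0 < t \<Longrightarrow> t \<le> 1 \<Longrightarrow> 0 \<le> t * s + t\<^sup>2 * K"
  shows "0 \<le> s"
proof (rule tendsto_lowerbound)
  show "((\<lambda>t. s + t * K) \<longlongrightarrow> s) (at_right 0)"
    by (auto intro!: tendsto_eq_intros)
  show "\<forall>\<^sub>F t in at_right 0. 0 \<le> s + t * K"
    unfolding eventually_at_right_field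
  proof (intro exI[of _ 1] conjI allI impI)
    fix t :: real assume "0 < t" "t < 1"
    then show "0 \<le> s + t * K"
      using assms[of t] by (simp add: power2_eq_square mult.assoc zero_le_mult_iff flip: distrib_left)
  qed simp
qed simp

lemma inner_transpose_mult: "v \<bullet> (transpose W *v u) = u \<bullet> (W *v v)"
  for W :: "real ^ 'q::finite ^ 'p::finite"
  by (metis dot_lmul_matrix inner_commute transpose_matrix_vector)

lemma f_obj_eq:
  assumes "Y *v 1 = 1" "Omega Y = ereal c"
  shows "f_obj n tr l Y = ereal (g_loss n tr Y + l * c)"
  using assms by (simp add: f_obj_def chi_E_def row_sum_one_def)

theorem theorem3p3:
  fixes n :: nat and tr :: "nat \<Rightarrow> 'd::finite" and lam :: real
    and X :: "real ^ 'd ^ 'd" and U V :: "real ^ 's::finite ^ 'd"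
  assumes "n \<ge> 1" and "lam > 0"
    and "X = U ** transpose V"
    and "U \<in> row_stochastic_mats" and "V \<in> col_stochastic_mats"
    and "\<forall>j. column j U \<noteq> 0"
  shows "((global_minimizer (f_obj n tr lam) X \<and> optimal_factorization X U V) \<longleftrightarrow>
           (\<exists>\<mu>. optimality_conditions (gradient (g_loss n tr) X) lam U V \<mu>)) \<and>
         (\<forall>\<mu> \<mu>'. optimality_conditions (gradient (g_loss n tr) X) lam U V \<mu> \<and>
                 optimality_conditions (gradient (g_loss n tr) X) lam U V \<mu>' \<longrightarrow> \<mu> = \<mu>')"
proof -
  define G where "G = gradient (g_loss n tr) X"
  define w where "w = (\<Sum>j\<in>UNIV. norm (column j U) * norm (column j V))"
  have nonneg: "nonneg_mat U" "nonneg_mat V"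
    using assms(4,5) by (auto simp: row_stochastic_mats_def col_stochastic_mats_def)
  have U0: "column j U \<noteq> 0" and V0: "column j V \<noteq> 0" for j
    using assms(5,6) column_col_stochastic_nonzero by blast+
  have X1: "X *v 1 = 1"
    using assms(3,4,5) row_sum_one_mult_transpose by blast
  have X_sum: "X = (\<Sum>j\<in>UNIV. outer (column j U) (column j V))"
    using assms(3) matrix_mult_transpose_eq_sum_outer by blast
  have cost_X: "factor_cost X w"
    unfolding X_sum w_def using nonneg
    by (intro factor_cost_sum factor_cost_outer nonneg_vec_column) auto
  have inner_X: "W \<bullet> X = (\<Sum>j\<in>UNIV. column j U \<bullet> (W *v column j V))" for W
    by (simp add: X_sum inner_sum_right inner_commute[of W] inner_outer)
  have opt_iff: "optimal_factorization X U V \<longleftrightarrow> Omega X = ereal w"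
    using nonneg assms(3) by (simp add: optimal_factorization_def w_def)
  note oc = optimality_conditions_columnwise[OF assms(5), of G lam U]

  \<comment> \<open>Sufficiency of the conditions\<close>
  have "global_minimizer (f_obj n tr lam) X \<and> optimal_factorization X U V"
    if cond: "optimality_conditions G lam U V \<mu>" for \<mu>
  proof -
    define W where "W = outer \<mu> 1 - G"
    note cond = cond[unfolded oc, folded W_def]
    have W_le: "W \<bullet> Y \<le> lam * c" if "factor_cost Y c" for Y c
      using inner_le_factor_cost[OF bilinear_bound_homogeneous that] cond by blast
    \<comment> \<open>Condition (b) at column \<open>j\<close>, with
      \<open>r = lam * norm (column j V)\<close>.\<close>
    have "column j U \<bullet> (W *v column j V) = lam * norm (column j V) * norm (column j U)" for j
      using cond U0 V0 assms(2) nonneg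
      by (intro inner_eq_of_max_zero_eq nonneg_vec_column) auto
    then have W_X: "W \<bullet> X = lam * w"
      by (simp add: inner_X w_def sum_distrib_left mult_ac)
    \<comment> \<open>Every cost \<open>c\<close> of \<open>X\<close> satisfies
      \<open>lam * w = W \<bullet> X \<le> lam * c\<close>.\<close>
    have "ereal w \<le> Omega X"
      using W_le[of X] W_X assms(2) by (intro Omega_ge) simp
    with Omega_le[OF cost_X] have Om: "Omega X = ereal w" by simp
    have "f_obj n tr lam X \<le> f_obj n tr lam Y" for Y
    proof (cases "Y *v 1 = 1")
      case True
      have "ereal ((W \<bullet> Y) / lam) \<le> Omega Y"
        using W_le assms(2) by (intro Omega_ge) (simp add: divide_le_eq mult.commute)
      then have "ereal lam * ereal ((W \<bullet> Y) / lam) \<le> ereal lam * Omega Y"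
        using assms(2) by (intro ereal_mult_left_mono) auto
      then have Om_Y: "ereal (W \<bullet> Y) \<le> ereal lam * Omega Y"
        using assms(2) by simp
      \<comment> \<open>The term with \<open>\<mu>\<close> pairs to
        \<open>\<mu> \<bullet> ((Y - X) *v 1)\<close>, which is zero because both row sums are
        one.\<close>
      have "W \<bullet> (Y - X) = - (G \<bullet> (Y - X))"
        by (simp add: W_def inner_diff_left[of "outer _ _"] inner_outer
            matrix_vector_mult_diff_rdistrib True X1)
      moreover have "g_loss n tr X + G \<bullet> (Y - X) \<le> g_loss n tr Y"
        using g_loss_expand[of n tr X 1 "Y - X"] by (simp add: G_def)
      ultimately have "g_loss n tr X + lam * w \<le> g_loss n tr Y + W \<bullet> Y"
        using W_X by (simp add: inner_diff_right)
      then have "f_obj n tr lam X \<le> ereal (g_loss n tr Y) + ereal (W \<bullet> Y)"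
        by (simp add: f_obj_eq[OF X1 Om])
      also have "\<dots> \<le> f_obj n tr lam Y"
        using True add_left_mono[OF Om_Y, of "ereal (g_loss n tr Y)"]
        by (simp add: f_obj_def chi_E_def row_sum_one_def)
      finally show ?thesis .
    qed (simp add: f_obj_def chi_E_def row_sum_one_def)
    then show ?thesis
      using Om opt_iff by (simp add: global_minimizer_def)
  qed

  \<comment> \<open>Necessity of the conditions\<close>
  moreover have "\<exists>\<mu>. optimality_conditions G lam U V \<mu>"
    if min: "global_minimizer (f_obj n tr lam) X" and "optimal_factorization X U V"
  proof -
    have Om: "Omega X = ereal w" using that opt_iff by simp
    have first_order: "0 \<le> G \<bullet> (Y - X) + lam * (c - w)" if Y: "factor_cost Y c" "Y *v 1 = 1" for Y c
    proof (rule linear_coeff_nonneg)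
      fix t :: real assume t: "0 < t" "t \<le> 1"
      \<comment> \<open>\<open>Z\<close> lies on the segment from \<open>X\<close> to
        \<open>Y\<close> and stays feasible. The interpolated cost \<open>d\<close> bounds
        \<open>Omega Z\<close> from above, so minimality of \<open>X\<close> can be tested with
        \<open>d\<close> in place of \<open>Omega Z\<close>.\<close>
      define Z d where "Z = X + t *\<^sub>R (Y - X)" and "d = (1 - t) * w + t * c"
      have Z: "Z = (1 - t) *\<^sub>R X + t *\<^sub>R Y"
        by (simp add: Z_def algebra_simps)
      have "factor_cost Z d"
        unfolding Z d_def using t Y cost_X by (intro factor_cost_add factor_cost_scaleR) auto
      then have "ereal lam * Omega Z \<le> ereal (lam * d)"
        using ereal_mult_left_mono[OF Omega_le, of Z d "ereal lam"] assms(2) by simp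
      moreover have "Z *v 1 = 1"
        by (simp add: Z matrix_vector_mult_add_rdistrib scaleR_matrix_vector_assoc[symmetric] X1 Y
            flip: scaleR_left_distrib)
      ultimately have "f_obj n tr lam Z \<le> ereal (g_loss n tr Z + lam * d)"
        by (simp add: f_obj_def chi_E_def row_sum_one_def add_left_mono flip: plus_ereal.simps(1))
      then have "ereal (g_loss n tr X + lam * w) \<le> ereal (g_loss n tr Z + lam * d)"
        using min by (metis f_obj_eq[OF X1 Om] global_minimizer_def order_trans)
      then show "0 \<le> t * (G \<bullet> (Y - X) + lam * (c - w))
          + t\<^sup>2 * (1 / 2 * (norm (diag (emp_freq n tr) ** (Y - X)))\<^sup>2)"
        unfolding Z_def d_def g_loss_expand G_def[symmetric] by (simp add: algebra_simps)
    qed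
    obtain \<mu> where mu: "\<And>Y c. factor_cost Y c \<Longrightarrow> (outer \<mu> 1 - G) \<bullet> (Y - X) \<le> lam * (c - w)"
      using exists_row_sum_multiplier[OF X1 first_order] by blast
    define W where "W = outer \<mu> 1 - G"
    \<comment> \<open>Testing at \<open>2 *\<^sub>R X\<close> with cost \<open>2 * w\<close> and at
      \<open>0\<close> with cost \<open>0\<close> gives the two inequalities.\<close>
    have W_X: "W \<bullet> X = lam * w"
      using mu[OF factor_cost_scaleR[OF cost_X, of 2]] mu[OF factor_cost_zero]
      by (simp add: W_def[symmetric] algebra_simps)
    have bound: "u \<bullet> (W *v v) \<le> lam * (norm u * norm v)" if "nonneg_vec u" "nonneg_vec v" for u v
      using mu[OF factor_cost_outer[OF that]] W_X
      by (simp add: W_def[symmetric] inner_commute[of W "outer _ _"] inner_outer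
          algebra_simps)
    \<comment> \<open>The bound holds in each summand and the two totals agree, so no summand can be
      strict.\<close>
    have attained: "column j U \<bullet> (W *v column j V) = lam * (norm (column j U) * norm (column j V))" for j
    proof (rule sum_mono_inv[of "\<lambda>j. column j U \<bullet> (W *v column j V)" UNIV])
      show "(\<Sum>j\<in>UNIV. column j U \<bullet> (W *v column j V))
          = (\<Sum>j\<in>UNIV. lam * (norm (column j U) * norm (column j V)))"
        using W_X by (simp add: inner_X w_def sum_distrib_left)
    qed (use nonneg in \<open>auto intro: bound nonneg_vec_column\<close>)
    \<comment> \<open>With \<open>column j V\<close> fixed, \<open>column j U\<close> attains the
      bound among nonnegative vectors; for (c) the roles are exchanged through the
      transpose.\<close>
    have b: "max ((W *v column j V) $ a) 0
        = lam * norm (column j V) / norm (column j U) * column j U $ a" for j a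
      using bound[of _ "column j V"] attained[of j] U0 nonneg assms(2)
      by (intro max_zero_eq_of_inner_attained) (auto simp: nonneg_vec_column mult_ac)
    have c: "max ((transpose W *v column j U) $ a) 0
        = lam * norm (column j U) / norm (column j V) * column j V $ a" for j a
      using bound[of "column j U"] attained[of j] V0 nonneg assms(2)
      by (intro max_zero_eq_of_inner_attained)
        (auto simp: nonneg_vec_column mult_ac inner_transpose_mult simp del: transpose_matrix_vector)
    have "u \<bullet> (W *v v) \<le> lam" if "nonneg_vec u" "nonneg_vec v" "norm u = 1" "norm v = 1" for u v
      using bound[of u v] that by simp
    with b c show ?thesis
      unfolding oc W_def[symmetric] by (intro exI[of _ \<mu>]) (auto simp: W_def)
  qed

  \<comment> \<open>Uniqueness of the multiplier\<close>
  moreover have "\<mu> = \<mu>'"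
    if "optimality_conditions G lam U V \<mu>" "optimality_conditions G lam U V \<mu>'" for \<mu> \<mu>'
  proof -
    \<comment> \<open>Where \<open>U\<close> has a positive entry, the positive part in (b) is
      positive, so truncation is inactive and the equation can be solved for
      \<open>\<nu> $ a\<close>.\<close>
    have determined: "\<nu> $ a = lam * norm (column j V) / norm (column j U) * U $ a $ j + (G ** V) $ a $ j"
      if "optimality_conditions G lam U V \<nu>" "0 < U $ a $ j" for \<nu> a j
    proof -
      have "max ((outer \<nu> 1 - G ** V) $ a $ j) 0
          = lam * norm (column j V) / norm (column j U) * U $ a $ j"
        using that(1) unfolding optimality_conditions_def
        by (simp add: pos_part_def vec_eq_iff matrix_mult_diag_nth mult_ac)
      moreover have "0 < lam * norm (column j V) / norm (column j U) * U $ a $ j"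
        using that(2) U0 V0 assms(2) by simp
      ultimately show ?thesis by (simp add: outer_def max_def split: if_splits)
    qed
    \<comment> \<open>Each row of \<open>U\<close> sums to one, so every component of the multiplier
      is determined in this way.\<close>
    have "\<exists>j. 0 < U $ a $ j" for a
    proof (rule ccontr)
      assume "\<nexists>j. 0 < U $ a $ j"
      then have "(U *v 1) $ a \<le> 0"
        by (auto simp: matrix_vector_mult_def not_less intro: sum_nonpos)
      then show False using assms(4) by (simp add: row_stochastic_mats_def)
    qed
    then show ?thesis
      using determined that by (metis vec_eq_iff)
  qed

  ultimately show ?thesis unfolding G_def by blast
qed

end
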